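(* There exists a rectifiable curve of finite length $K_0 \subset \mathbb{R}^2$ such that, with $\mu = \mathcal{H}^1 \llcorner K_0$, for every $x \in K_0$ and every $\delta > 0$, $$\int_{B_\delta(x)} \int_0^\delta \beta_{\mu;2}^1(y,r)^2 \, \frac{dr}{r} \, d\mu(y) = \infty .$$
   Context: $\mathcal{H}^1$ is one-dimensional Hausdorff measure on $\mathbb{R}^2$ (normalized so that a unit segment has measure $1$), $\mathcal{H}^1 \llcorner E$ is its restriction to $E$, and $B_r(x) = B(x,r)$ is the ball of center $x$ and radius $r$. A rectifiable curve is the image of a continuous map from a compact interval into $\mathbb{R}^2$ of finite length. For $E \subset \mathbb{R}^2$ and $\mu = \mathcal{H}^1 \llcorner E$, the Jones $\beta$-number is $$\beta_{\mu;2}^1(x,r) = \beta_{E;2}^1(x,r) = \left( \inf_{L} \int_{B(x,r)} \left( \frac{\operatorname{dist}(y,L)}{r} \right)^2 \frac{d\mu(y)}{r} \right)^{1/2},$$ where the infimum is over all (affine) lines $L \subset \mathbb{R}^2$. *)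

theory Defs
  imports "HOL-Analysis.Analysis"
begin

(* The library's "diameter" is real-valued and unspecified on unbounded sets. *)
definition ediameter :: "'a::metric_space set \<Rightarrow> ennreal" where
  "ediameter S = (SUP x\<in>S. SUP y\<in>S. ennreal (dist x y))"

(* The size-d approximation to the Hausdorff outer measure. Finite covers are included, since
   some of the A i may be empty. Weighting each piece by exactly its diameter gives a unit
   segment measure 1. *)
definition hausdorff1_pre :: "real \<Rightarrow> 'a::metric_space set \<Rightarrow> ennreal" where
  "hausdorff1_pre d E =
     (INF A\<in>{A :: nat \<Rightarrow> 'a set. E \<subseteq> (\<Union>i. A i) \<and> (\<forall>i. ediameter (A i) \<le> ennreal d)}.
        \<Sum>i. ediameter (A i))"

definition hausdorff1 :: "'a::metric_space set \<Rightarrow> ennreal" where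
  "hausdorff1 E = (SUP d\<in>{0<..}. hausdorff1_pre d E)"

(* The restriction of one-dimensional Hausdorff measure to E, as a Borel measure on the whole
   space. Since hausdorff1 is a metric outer measure, Borel sets are Caratheodory measurable for
   it, so A \<mapsto> hausdorff1 (A \<inter> E) is countably additive on Borel sets for
   every E, and measure_of does not fall back to the zero measure. *)
definition hausdorff1_restrict :: "'a::metric_space set \<Rightarrow> 'a measure" where
  "hausdorff1_restrict E = measure_of UNIV (sets borel) (\<lambda>A. hausdorff1 (A \<inter> E))"

definition curve_length :: "(real \<Rightarrow> 'a::metric_space) \<Rightarrow> real \<Rightarrow> real \<Rightarrow> ennreal" where
  "curve_length g a b =
     (SUP (n, t)\<in>{(n :: nat, t :: nat \<Rightarrow> real). mono_on {..n} t \<and> t ` {..n} \<subseteq> {a..b}}.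
        \<Sum>i<n. ennreal (dist (g (t i)) (g (t (Suc i)))))"

definition rectifiable_curve :: "'a::metric_space set \<Rightarrow> bool" where
  "rectifiable_curve K \<longleftrightarrow>
     (\<exists>(g :: real \<Rightarrow> 'a) a b.
        a \<le> b \<and> continuous_on {a..b} g \<and> curve_length g a b < \<infinity> \<and> K = g ` {a..b})"

definition ennreal_sqrt :: "ennreal \<Rightarrow> ennreal" where
  "ennreal_sqrt x = (if x = \<infinity> then \<infinity> else ennreal (sqrt (enn2real x)))"

definition affine_lines :: "(real^2) set set" where
  "affine_lines = {L. affine L \<and> aff_dim L = 1}"

(* Only r > 0 is meaningful. *)
definition jones_beta :: "(real^2) measure \<Rightarrow> real^2 \<Rightarrow> real \<Rightarrow> ennreal" where
  "jones_beta \<mu> x r =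
     ennreal_sqrt (INF L\<in>affine_lines.
       \<integral>\<^sup>+y\<in>ball x r. ennreal ((infdist y L / r)^2 / r) \<partial>\<mu>)"

end

theory Submission
  imports Defs
begin

text \<open>
  The curve is the graph over \<open>{0..1}\<close> of a continuous function of bounded variation,
  \<open>profile = (\<Sum>k. wiggle k)\<close>. The summand \<open>wiggle k\<close> oscillates \<open>N\<close> times with
  amplitude \<open>h\<close> over an interval of length \<open>w\<close> that starts at \<open>site k\<close>, and vanishes
  outside it. The theorem rests on the different powers of \<open>N\<close> in the length of such a
  cluster and in its contribution to the integral. The length is of the order \<open>N * h\<close>. Inside the
  cluster there is a square of side \<open>w \<le> h\<close> that the graph crosses \<open>N\<close> times from bottom to
  top, so its corners have measure of the order \<open>N * w\<close>. At radii comparable to \<open>w\<close>, no line is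
  close to all of its corners, hence \<open>\<beta>\<^sup>2\<close> is at least a multiple of
  \<open>N\<close>. Integrating over the points of the square gives a contribution of the order
  \<open>N * (N * w) = N\<^sup>2 * w\<close>. One can let \<open>N * h = 2 ^ (- k)\<close> be summable while \<open>N\<^sup>2 * w\<close> tends
  to infinity, even with \<open>w\<close> much smaller than \<open>h\<close>. As the sites are dense, every ball around a
  point of the curve contains such squares with \<open>k\<close> as large as desired, and already single
  squares force the integral to exceed every bound.

  Taking \<open>w\<close> much smaller than \<open>h\<close> is what separates the clusters: the summands before
  \<open>wiggle k\<close> are Lipschitz and hardly change over an interval of length \<open>w\<close>, and those after it are
  uniformly small (\<open>profile_near_wiggle\<close>). Only lower bounds for the measure are needed, and they
  come from \<open>hausdorff1_graph_crossings\<close>: a crossing of a strip is at least as long as its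
  projection. Adding up the crossings requires that Borel sets be measurable for the Hausdorff
  outer measure, which is Caratheodory's criterion for metric outer measures
  (\<open>hausdorff1_closed_caratheodory\<close>).
\<close>

section \<open>Hausdorff measure as a metric outer measure\<close>

lemma ediameter_empty [simp]: "ediameter {} = 0"
  by (simp add: ediameter_def bot_ennreal)

lemma dist_le_ediameter:
  "x \<in> S \<Longrightarrow> y \<in> S \<Longrightarrow> ennreal (dist x y) \<le> ediameter S"
  unfolding ediameter_def by (meson SUP_upper2 order_refl)

lemma hausdorff1_pre_le:
  assumes "E \<subseteq> (\<Union>i. A i)" "\<And>i. ediameter (A i) \<le> ennreal d"
  shows "hausdorff1_pre d E \<le> (\<Sum>i. ediameter (A i))"
  unfolding hausdorff1_pre_def using assms by (intro INF_lower) auto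

lemma hausdorff1_pre_mono: "E \<subseteq> F \<Longrightarrow> hausdorff1_pre d E \<le> hausdorff1_pre d F"
  unfolding hausdorff1_pre_def by (rule INF_superset_mono) auto

lemma hausdorff1_pre_antimono: "d \<le> e \<Longrightarrow> hausdorff1_pre e E \<le> hausdorff1_pre d E"
  unfolding hausdorff1_pre_def
  by (rule INF_superset_mono) (auto intro: order_trans ennreal_leI)

lemma hausdorff1_pre_le_hausdorff1: "d > 0 \<Longrightarrow> hausdorff1_pre d E \<le> hausdorff1 E"
  unfolding hausdorff1_def by (rule SUP_upper) auto

lemma hausdorff1_mono: "E \<subseteq> F \<Longrightarrow> hausdorff1 E \<le> hausdorff1 F"
  unfolding hausdorff1_def by (rule SUP_mono) (auto intro: hausdorff1_pre_mono)

lemma hausdorff1_empty [simp]: "hausdorff1 ({} :: 'a::metric_space set) = 0"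
proof -
  have "hausdorff1_pre d ({} :: 'a set) = 0" for d
    using hausdorff1_pre_le[of "{} :: 'a set" "\<lambda>_. {}" d] by simp
  then show ?thesis
    unfolding hausdorff1_def by simp
qed

lemma hausdorff1_pre_countably_subadditive:
  "hausdorff1_pre d (\<Union>n. A n) \<le> (\<Sum>n. hausdorff1_pre d (A n))"
proof (rule ennreal_le_epsilon)
  fix e :: real assume "0 < e" and fin: "(\<Sum>n. hausdorff1_pre d (A n)) < top"
  have "\<exists>B. A n \<subseteq> (\<Union>i. B i) \<and> (\<forall>i. ediameter (B i) \<le> ennreal d) \<and>
      (\<Sum>i. ediameter (B i)) \<le> hausdorff1_pre d (A n) + e * (1/2)^Suc n" for n
  proof -
    have "hausdorff1_pre d (A n) < hausdorff1_pre d (A n) + e * (1/2)^Suc n"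
      using fin \<open>0 < e\<close> by (auto simp add: less_top dest!: ennreal_suminf_lessD)
    then show ?thesis
      unfolding hausdorff1_pre_def[of d "A n"] INF_less_iff using less_imp_le by blast
  qed
  then obtain B where B: "\<And>n. A n \<subseteq> (\<Union>i. B n i)" "\<And>n i. ediameter (B n i) \<le> ennreal d"
      "\<And>n. (\<Sum>i. ediameter (B n i)) \<le> hausdorff1_pre d (A n) + e * (1/2)^Suc n"
    by metis
  define C where "C = case_prod B \<circ> prod_decode"
  have "(\<Union>n. A n) \<subseteq> (\<Union>i. C i)"
    using B(1) by (auto simp add: C_def subset_eq) (metis prod.case prod_encode_inverse)
  then have "hausdorff1_pre d (\<Union>n. A n) \<le> (\<Sum>i. ediameter (C i))"
    by (rule hausdorff1_pre_le) (auto simp: C_def split_def B(2))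
  also have "\<dots> = (\<Sum>n. \<Sum>i. ediameter (B n i))"
    unfolding C_def comp_def by (intro suminf_ennreal_2dimen) auto
  also have "\<dots> \<le> (\<Sum>n. hausdorff1_pre d (A n) + e * (1/2) ^ Suc n)"
    by (intro suminf_le allI B(3)) auto
  also have "\<dots> = (\<Sum>n. hausdorff1_pre d (A n)) + (\<Sum>n. ennreal e * ennreal ((1/2) ^ Suc n))"
    using \<open>0 < e\<close> by (subst suminf_add[symmetric])
      (auto simp del: ennreal_suminf_cmult simp add: ennreal_mult[symmetric])
  also have "\<dots> = (\<Sum>n. hausdorff1_pre d (A n)) + e"
    unfolding ennreal_suminf_cmult
    by (subst suminf_ennreal_eq[OF zero_le_power power_half_series]) auto
  finally show "hausdorff1_pre d (\<Union>n. A n) \<le> (\<Sum>n. hausdorff1_pre d (A n)) + e" .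
qed

lemma hausdorff1_countably_subadditive: "hausdorff1 (\<Union>n. A n) \<le> (\<Sum>n. hausdorff1 (A n))"
proof -
  have "hausdorff1_pre d (\<Union>n. A n) \<le> (\<Sum>n. hausdorff1 (A n))" if "d > 0" for d
    by (rule order_trans[OF hausdorff1_pre_countably_subadditive])
      (intro suminf_le hausdorff1_pre_le_hausdorff1 that summableI)
  then show ?thesis
    unfolding hausdorff1_def[of "\<Union>n. A n"] by (intro SUP_least) auto
qed

lemma hausdorff1_Un_le: "hausdorff1 (A \<union> B) \<le> hausdorff1 A + hausdorff1 B"
proof -
  have "hausdorff1 (\<Union>n. binaryset A B n) \<le> (\<Sum>n. hausdorff1 (binaryset A B n))"
    by (rule hausdorff1_countably_subadditive)
  also have "\<dots> = hausdorff1 A + hausdorff1 B"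
    by (intro suminf_binaryset_eq) simp
  finally show ?thesis by (simp add: UN_binaryset_eq)
qed

text \<open>
  This is what makes \<^const>\<open>hausdorff1\<close> a metric outer measure: a set of diameter less than
  the distance between \<open>A\<close> and \<open>B\<close> cannot meet both of them, so a fine cover
  of \<open>A \<union> B\<close> splits into a cover of \<open>A\<close> and a cover of \<open>B\<close>.
\<close>

lemma hausdorff1_separated:
  assumes "e > 0" and sep: "\<And>a b. a \<in> A \<Longrightarrow> b \<in> B \<Longrightarrow> e \<le> dist a b"
  shows "hausdorff1 A + hausdorff1 B \<le> hausdorff1 (A \<union> B)"
proof -
  have split: "hausdorff1_pre d A + hausdorff1_pre d B \<le> hausdorff1_pre d (A \<union> B)"
    if d: "d < e" for d
    unfolding hausdorff1_pre_def[of d "A \<union> B"]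
  proof (rule INF_greatest, clarify)
    fix C :: "nat \<Rightarrow> 'a set"
    assume C: "A \<union> B \<subseteq> (\<Union>i. C i)" "\<forall>i. ediameter (C i) \<le> ennreal d"
    let ?R = "\<lambda>S i. if C i \<inter> S \<noteq> {} then C i else {}"
    have "C i \<inter> A = {} \<or> C i \<inter> B = {}" for i
    proof (rule ccontr)
      assume "\<not> ?thesis"
      then obtain a b where ab: "a \<in> C i" "a \<in> A" "b \<in> C i" "b \<in> B" by blast
      then have "ennreal (dist a b) \<le> ennreal d"
        using C(2) dist_le_ediameter order_trans by blast
      moreover have "e \<le> dist a b" using sep ab by blast
      ultimately have "ennreal e \<le> ennreal d" using ennreal_leI order_trans by blast
      then show False using d \<open>e > 0\<close> by (cases "0 \<le> d") (auto simp: ennreal_neg)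
    qed
    then have le: "ediameter (?R A i) + ediameter (?R B i) \<le> ediameter (C i)" for i by auto
    have "hausdorff1_pre d A \<le> (\<Sum>i. ediameter (?R A i))"
      using C by (intro hausdorff1_pre_le) fastforce+
    moreover have "hausdorff1_pre d B \<le> (\<Sum>i. ediameter (?R B i))"
      using C by (intro hausdorff1_pre_le) fastforce+
    ultimately have "hausdorff1_pre d A + hausdorff1_pre d B \<le>
        (\<Sum>i. ediameter (?R A i)) + (\<Sum>i. ediameter (?R B i))"
      by (rule add_mono)
    also have "\<dots> = (\<Sum>i. ediameter (?R A i) + ediameter (?R B i))"
      by (rule suminf_add) auto
    also have "\<dots> \<le> (\<Sum>i. ediameter (C i))"
      by (intro suminf_le le) auto
    finally show "hausdorff1_pre d A + hausdorff1_pre d B \<le> (\<Sum>i. ediameter (C i))" .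
  qed
  have "hausdorff1 A + hausdorff1 B = (SUP d\<in>{0<..}. hausdorff1_pre d A + hausdorff1_pre d B)"
    unfolding hausdorff1_def
  proof (rule SUP_add_directed_ennreal[symmetric])
    fix c d :: real assume "c \<in> {0<..}" "d \<in> {0<..}"
    then show "\<exists>k\<in>{0<..}. hausdorff1_pre c A + hausdorff1_pre d B \<le>
        hausdorff1_pre k A + hausdorff1_pre k B"
      by (intro bexI[of _ "min c d"] add_mono hausdorff1_pre_antimono) auto
  qed
  also have "\<dots> \<le> hausdorff1 (A \<union> B)"
  proof (rule SUP_least)
    fix d :: real assume d: "d \<in> {0<..}"
    define k where "k = min d (e/2)"
    have k: "0 < k" "k < e" "k \<le> d" using d \<open>e > 0\<close> by (auto simp: k_def)
    have "hausdorff1_pre d A + hausdorff1_pre d B \<le> hausdorff1_pre k A + hausdorff1_pre k B"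
      using k by (intro add_mono hausdorff1_pre_antimono)
    also have "\<dots> \<le> hausdorff1_pre k (A \<union> B)" using split k by blast
    also have "\<dots> \<le> hausdorff1 (A \<union> B)" using k by (intro hausdorff1_pre_le_hausdorff1)
    finally show "hausdorff1_pre d A + hausdorff1_pre d B \<le> hausdorff1 (A \<union> B)" .
  qed
  finally show ?thesis .
qed

lemma ennreal_suminf_tail_tendsto_0:
  fixes f :: "nat \<Rightarrow> ennreal"
  assumes "(\<Sum>n. f n) \<noteq> \<infinity>"
  shows "(\<lambda>n. \<Sum>i. f (i + n)) \<longlonglongrightarrow> 0"
proof -
  have "(\<lambda>n. (\<Sum>n. f n) - (\<Sum>i<n. f i)) \<longlonglongrightarrow> (\<Sum>n. f n) - (\<Sum>n. f n)"
    using assms by (intro tendsto_diff_ennreal tendsto_const summable_LIMSEQ) auto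
  moreover have "(\<Sum>n. f n) - (\<Sum>i<n. f i) = (\<Sum>i. f (i + n))" for n
  proof -
    have "(\<Sum>i<n. f i) \<noteq> \<infinity>"
      using assms sum_le_suminf[OF summableI, of "{..<n}" f]
      by (metis finite_lessThan infinity_ennreal_def neq_top_trans zero_le)
    then show ?thesis
      using suminf_offset[OF summableI, of f n] by (simp add: ennreal_add_diff_cancel)
  qed
  ultimately show ?thesis using assms by simp
qed

text \<open>
  The two separated pieces \<open>X \<inter> C\<close> and \<open>{x \<in> X. infdist x C \<ge> 1 / (n + 1)}\<close> add up.
  What the second piece misses of \<open>X - C\<close> lies in thin shells around \<open>C\<close>. Shells of equal parity
  are separated from each other, so the measures of all shells have a finite sum, and the missed
  part has measure tending to 0.
\<close>

lemma hausdorff1_closed_caratheodory: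
  fixes C :: "'a::metric_space set"
  assumes "closed C"
  shows "hausdorff1 (X \<inter> C) + hausdorff1 (X - C) = hausdorff1 X"
proof (rule antisym)
  show "hausdorff1 X \<le> hausdorff1 (X \<inter> C) + hausdorff1 (X - C)"
    using hausdorff1_Un_le[of "X \<inter> C" "X - C"] by (simp add: Int_Diff_Un)
next
  show "hausdorff1 (X \<inter> C) + hausdorff1 (X - C) \<le> hausdorff1 X"
  proof (cases "C = {} \<or> hausdorff1 X = \<infinity>")
    case True
    then show ?thesis by auto
  next
    case False
    then have ne: "C \<noteq> {}" and fin: "hausdorff1 X \<noteq> \<infinity>" by auto
    define F where "F n = {x \<in> X. 1 / (real n + 1) \<le> infdist x C}" for n
    define D where "D n = {x \<in> X. 1 / (real n + 2) \<le> infdist x C \<and> infdist x C < 1 / (real n + 1)}"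
      for n
    have lip: "infdist x C - infdist y C \<le> dist x y" for x y
      using infdist_triangle[of x C y] by simp
    have parity: "(\<Sum>i<n. hausdorff1 (D (2 * i + p))) \<le> hausdorff1 (\<Union>i<n. D (2 * i + p))" for n p
    proof (induction n)
      case 0
      then show ?case by simp
    next
      case (Suc n)
      have "hausdorff1 (\<Union>i<n. D (2 * i + p)) + hausdorff1 (D (2 * n + p)) \<le>
          hausdorff1 ((\<Union>i<n. D (2 * i + p)) \<union> D (2 * n + p))"
      proof (cases "n = 0")
        case True
        then show ?thesis by simp
      next
        case False
        let ?e = "1 / real (2 * n + p) - 1 / (real (2 * n + p) + 1)"
        show ?thesis
        proof (rule hausdorff1_separated)
          show "?e > 0" using False by (simp add: frac_less2)
          fix a b assume a: "a \<in> (\<Union>i<n. D (2 * i + p))" and b: "b \<in> D (2 * n + p)"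
          then obtain i where i: "i < n" "a \<in> D (2 * i + p)" by auto
          then have "1 / real (2 * n + p) \<le> 1 / (real (2 * i + p) + 2)"
            by (intro divide_left_mono) auto
          also have "\<dots> \<le> infdist a C" using i by (simp add: D_def)
          finally have "1 / real (2 * n + p) \<le> infdist a C" .
          moreover have "infdist b C < 1 / (real (2 * n + p) + 1)" using b by (simp add: D_def)
          ultimately show "?e \<le> dist a b" using lip[of a b] by simp
        qed
      qed
      moreover have "(\<Union>i<Suc n. D (2 * i + p)) = (\<Union>i<n. D (2 * i + p)) \<union> D (2 * n + p)"
        by (auto simp: lessThan_Suc)
      ultimately show ?case 
        using Suc.IH by (auto intro: order_trans[OF add_right_mono])
    qed
    have parity': "(\<Sum>i. hausdorff1 (D (2 * i + p))) \<le> hausdorff1 X" for p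
    proof (rule suminf_le_const[OF summableI])
      fix n
      have "(\<Union>i<n. D (2 * i + p)) \<subseteq> X" by (auto simp: D_def)
      then show "(\<Sum>i<n. hausdorff1 (D (2 * i + p))) \<le> hausdorff1 X"
        using parity order_trans hausdorff1_mono by blast
    qed
    have "(\<Sum>i. hausdorff1 (D i)) \<le> hausdorff1 X + hausdorff1 X"
    proof (rule suminf_le_const[OF summableI])
      fix n
      have "(\<Sum>i<n. hausdorff1 (D i)) \<le> (\<Sum>i<2*n. hausdorff1 (D i))"
        by (intro sum_mono2) auto
      also have "\<dots> = (\<Sum>i<n. hausdorff1 (D (2 * i + 0))) + (\<Sum>i<n. hausdorff1 (D (2 * i + 1)))"
        by (induction n) (auto simp: algebra_simps)
      also have "\<dots> \<le> (\<Sum>i. hausdorff1 (D (2 * i + 0))) + (\<Sum>i. hausdorff1 (D (2 * i + 1)))"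
        by (intro add_mono sum_le_suminf) auto
      also have "\<dots> \<le> hausdorff1 X + hausdorff1 X"
        by (intro add_mono parity')
      finally show "(\<Sum>i<n. hausdorff1 (D i)) \<le> hausdorff1 X + hausdorff1 X" .
    qed
    then have "(\<Sum>i. hausdorff1 (D i)) \<noteq> \<infinity>"
      using fin by (metis ennreal_add_eq_top infinity_ennreal_def neq_top_trans)
    then have "(\<lambda>n. hausdorff1 X + (\<Sum>i. hausdorff1 (D (i + n)))) \<longlonglongrightarrow> hausdorff1 X + 0"
      by (intro tendsto_add tendsto_const ennreal_suminf_tail_tendsto_0)
    moreover have "hausdorff1 (X \<inter> C) + hausdorff1 (X - C) \<le>
        hausdorff1 X + (\<Sum>i. hausdorff1 (D (i + n)))" for n
    proof -
      have "X - C \<subseteq> F n \<union> (\<Union>i. D (i + n))"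
      proof
        fix x assume x: "x \<in> X - C"
        then have pos: "infdist x C > 0"
          using \<open>closed C\<close> ne by (simp add: infdist_pos_not_in_closed)
        show "x \<in> F n \<union> (\<Union>i. D (i + n))"
        proof (cases "x \<in> F n")
          case False
          define P where "P m \<longleftrightarrow> 1 / (real m + 1) \<le> infdist x C" for m
          have "\<exists>m. P m"
            using pos unfolding P_def
            by (metis less_imp_le nat_approx_posE of_nat_Suc add.commute)
          define m where "m = (LEAST m. P m)"
          have m: "P m" "\<And>k. k < m \<Longrightarrow> \<not> P k"
            using \<open>\<exists>m. P m\<close> not_less_Least LeastI_ex by (auto simp: m_def)
          have "\<not> P k" if "k \<le> n" for k
          proof
            assume "P k"
            moreover have "1 / (real n + 1) \<le> 1 / (real k + 1)"
              using that by (intro divide_left_mono) auto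
            ultimately have "1 / (real n + 1) \<le> infdist x C" by (simp add: P_def)
            then show False using False x by (simp add: F_def)
          qed
          then have "n < m" using m(1) by (meson not_le)
          then obtain i where i: "m = Suc (i + n)"
            by (metis add.commute less_imp_Suc_add)
          then have "x \<in> D (i + n)"
            using m(1) m(2)[of "i + n"] x by (auto simp: D_def P_def algebra_simps)
          then show ?thesis by blast
        qed simp
      qed
      then have "hausdorff1 (X - C) \<le> hausdorff1 (F n) + hausdorff1 (\<Union>i. D (i + n))"
        using hausdorff1_mono hausdorff1_Un_le order_trans by blast
      also have "\<dots> \<le> hausdorff1 (F n) + (\<Sum>i. hausdorff1 (D (i + n)))"
        by (intro add_mono order_refl hausdorff1_countably_subadditive)
      finally have "hausdorff1 (X \<inter> C) + hausdorff1 (X - C) \<le>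
          (hausdorff1 (X \<inter> C) + hausdorff1 (F n)) + (\<Sum>i. hausdorff1 (D (i + n)))"
        by (simp add: add.assoc add_left_mono)
      also have "hausdorff1 (X \<inter> C) + hausdorff1 (F n) \<le> hausdorff1 (X \<inter> C \<union> F n)"
      proof (rule hausdorff1_separated[of "1 / (real n + 1)"])
        fix a b assume "a \<in> X \<inter> C" "b \<in> F n"
        then show "1 / (real n + 1) \<le> dist a b"
          using lip[of b a] by (simp add: F_def dist_commute)
      qed simp
      also have "\<dots> \<le> hausdorff1 X"
        by (rule hausdorff1_mono) (auto simp: F_def)
      finally show ?thesis by (simp add: add_right_mono)
    qed
    ultimately show ?thesis
      by (intro LIMSEQ_le_const[where X="\<lambda>n. hausdorff1 X + (\<Sum>i. hausdorff1 (D (i + n)))"]) auto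
  qed
qed

lemma sets_hausdorff1_restrict [measurable_cong, simp]: "sets (hausdorff1_restrict E) = sets borel"
proof -
  have "sigma_sets UNIV (sets borel) = (sets borel :: 'a set set)"
    using sets.sigma_sets_eq[of "borel :: 'a measure"] by simp
  then show ?thesis by (simp add: hausdorff1_restrict_def)
qed

text \<open>
  For a set \<open>E\<close> that may be non-measurable, \<open>A \<mapsto> hausdorff1 (A \<inter> E)\<close> is still an outer
  measure, and closed sets are Caratheodory measurable for it, as the previous lemma allows an
  arbitrary test set \<open>X \<inter> E\<close>.
\<close>

lemma emeasure_hausdorff1_restrict:
  fixes E :: "'a::metric_space set"
  assumes "A \<in> sets borel"
  shows "emeasure (hausdorff1_restrict E) A = hausdorff1 (A \<inter> E)"
proof -
  define f where "f A = hausdorff1 (A \<inter> E)" for A :: "'a set"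
  define L where "L = lambda_system UNIV UNIV f"
  have "countably_subadditive UNIV f"
    unfolding countably_subadditive_def f_def
    using hausdorff1_countably_subadditive[of "\<lambda>n. _ n \<inter> E"] by auto
  then have "outer_measure_space UNIV f"
    by (auto simp: outer_measure_space_def positive_def increasing_def f_def intro!: hausdorff1_mono)
  then have ms: "measure_space UNIV L f"
    using sigma_algebra.caratheodory_lemma[OF sigma_algebra_Pow, of UNIV f] by (simp add: L_def)
  have "C \<in> L" if "closed C" for C
    using hausdorff1_closed_caratheodory[OF that, of "_ \<inter> E"]
    by (auto simp: L_def lambda_system_def f_def Int_ac Diff_eq)
  then have "sigma_sets UNIV (Collect closed) \<subseteq> L"
    using ms by (intro sigma_algebra.sigma_sets_subset) (auto simp: measure_space_def)
  then have borel: "sets borel \<subseteq> L"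
    by (simp add: borel_eq_closed)
  have "countably_additive (sets borel) f" "positive (sets borel) f"
    using ms borel unfolding measure_space_def countably_additive_def positive_def
    by (auto; blast)+
  then show ?thesis
    unfolding hausdorff1_restrict_def f_def[symmetric]
    using assms by (intro emeasure_measure_of[OF refl])
      (auto simp: sets.sigma_sets_eq[of "borel :: 'a measure", simplified])
qed

section \<open>Crossings of a strip by a graph\<close>

text \<open>
  A 1-Lipschitz function does not increase length: a piece of a cover is mapped into an interval
  of the same diameter.
\<close>

lemma hausdorff1_ge_image_length:
  fixes p :: "'a::metric_space \<Rightarrow> real"
  assumes lip: "\<And>x y. \<bar>p x - p y\<bar> \<le> dist x y" and sub: "{c..d} \<subseteq> p ` S"
  shows "ennreal (d - c) \<le> hausdorff1 S"
proof -
  have "ennreal (d - c) \<le> hausdorff1_pre 1 S"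
    unfolding hausdorff1_pre_def
  proof (rule INF_greatest, clarify)
    fix A :: "nat \<Rightarrow> 'a set"
    assume A: "S \<subseteq> (\<Union>i. A i)" "\<forall>i. ediameter (A i) \<le> ennreal 1"
    define J where "J i = (if A i = {} then {} else
      {Inf (p ` A i)..Inf (p ` A i) + enn2real (ediameter (A i))})" for i
    have fin: "ennreal (enn2real (ediameter (A i))) = ediameter (A i)" for i
      using A(2) by (metis ennreal_enn2real ennreal_less_top le_less_trans)
    have *: "p x \<in> J i" if "x \<in> A i" for x i
    proof -
      have bd: "p x \<le> p y + enn2real (ediameter (A i))" if "x \<in> A i" "y \<in> A i" for x y
      proof -
        have "ennreal (dist x y) \<le> ennreal (enn2real (ediameter (A i)))"
          unfolding fin using that by (rule dist_le_ediameter)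
        then have "dist x y \<le> enn2real (ediameter (A i))"
          by (simp add: ennreal_le_iff)
        then show ?thesis using lip[of x y] by simp
      qed
      have "bdd_below (p ` A i)"
        using bd[OF that] by (intro bdd_belowI[of _ "p x - enn2real (ediameter (A i))"]) force
      then have "Inf (p ` A i) \<le> p x" using that by (intro cInf_lower) auto
      moreover have "p x - enn2real (ediameter (A i)) \<le> Inf (p ` A i)"
        using bd[OF that] that by (intro cInf_greatest) force+
      ultimately show ?thesis using that by (auto simp: J_def)
    qed
    then have "p x \<in> (\<Union>i. J i)" if "x \<in> S" for x
    proof -
      obtain i where "x \<in> A i" using A(1) \<open>x \<in> S\<close> by blast
      then have "p x \<in> J i" by (rule *)
      then show ?thesis by blast
    qed
    then have "p ` S \<subseteq> (\<Union>i. J i)" by (rule image_subsetI)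
    then have "{c..d} \<subseteq> (\<Union>i. J i)" using sub by simp
    have "ennreal (d - c) \<le> emeasure lborel {c..d}"
      by (cases "c \<le> d") (auto simp: ennreal_neg)
    also have "\<dots> \<le> emeasure lborel (\<Union>i. J i)"
      using \<open>{c..d} \<subseteq> (\<Union>i. J i)\<close> by (intro emeasure_mono) (auto simp: J_def)
    also have "\<dots> \<le> (\<Sum>i. emeasure lborel (J i))"
      by (intro emeasure_subadditive_countably) (auto simp: J_def)
    also have "\<dots> = (\<Sum>i. ediameter (A i))"
      by (intro suminf_cong) (auto simp: J_def fin)
    finally show "ennreal (d - c) \<le> (\<Sum>i. ediameter (A i))" .
  qed
  also have "\<dots> \<le> hausdorff1 S" by (rule hausdorff1_pre_le_hausdorff1) simp
  finally show ?thesis .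
qed

definition graph_point :: "(real \<Rightarrow> real) \<Rightarrow> real \<Rightarrow> real^2" where
  "graph_point f t = vector [t, f t]"

lemma graph_point_nth [simp]: "graph_point f t $ 1 = t" "graph_point f t $ 2 = f t"
  by (auto simp: graph_point_def)

lemma vector_2_eq: "vector [x, y] = (\<chi> i. if i = (1::2) then x else y)"
  by (simp add: vec_eq_iff forall_2)

lemma continuous_on_graph_point:
  "continuous_on A f \<Longrightarrow> continuous_on A (graph_point f)"
  unfolding graph_point_def vector_2_eq
  apply (intro continuous_on_vec_lambda) subgoal for i by (cases "i = 1") simp_all done

definition rectangle :: "real \<Rightarrow> real \<Rightarrow> real \<Rightarrow> real \<Rightarrow> (real^2) set" where
  "rectangle a b c d = {z. z $ 1 \<in> {a..b} \<and> z $ 2 \<in> {c..d}}"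

lemma closed_rectangle: "closed (rectangle a b c d)"
proof -
  have "rectangle a b c d = ((\<lambda>z. z $ 1) -` {a..b}) \<inter> ((\<lambda>z. z $ 2) -` {c..d})"
    by (auto simp: rectangle_def)
  then show ?thesis
    by (auto intro!: closed_Int closed_vimage continuous_intros)
qed

lemma sets_rectangle [measurable, simp]: "rectangle a b c d \<in> sets borel"
  by (intro borel_closed closed_rectangle)

lemma dist_le_sum_abs_2: "dist (x :: real^2) y \<le> \<bar>x $ 1 - y $ 1\<bar> + \<bar>x $ 2 - y $ 2\<bar>"
  using norm_le_l1_cart[of "x - y"] by (simp add: dist_norm sum_2)

text \<open>
  Every crossing of the horizontal strip \<open>c \<le> y \<le> d\<close> has length at least \<open>d - c\<close>, because its
  projection to the vertical axis is onto \<open>{c..d}\<close>, and the crossings over disjoint intervals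
  add up.
\<close>

lemma hausdorff1_graph_crossings:
  fixes f :: "real \<Rightarrow> real" and a b :: "'i \<Rightarrow> real" and c d s e :: real
  assumes cont: "continuous_on T f"
    and fin: "finite I" and disj: "disjoint_family_on (\<lambda>i. {a i..b i}) I"
    and sub: "\<And>i. i \<in> I \<Longrightarrow> {a i..b i} \<subseteq> {s..e} \<inter> T"
    and ab: "\<And>i. i \<in> I \<Longrightarrow> a i \<le> b i \<and> f (a i) \<le> c \<and> d \<le> f (b i)"
  shows "ennreal (card I * (d - c)) \<le> hausdorff1 (rectangle s e c d \<inter> graph_point f ` T)"
proof (cases "c \<le> d")
  case True
  let ?K = "graph_point f ` T" and ?R = "\<lambda>i. rectangle (a i) (b i) c d"
  have one: "ennreal (d - c) \<le> hausdorff1 (?R i \<inter> ?K)" if i: "i \<in> I" for i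
  proof (rule hausdorff1_ge_image_length[where p="\<lambda>z. z $ 2"])
    show "\<bar>x $ 2 - y $ 2\<bar> \<le> dist x y" for x y :: "real^2"
      using component_le_norm_cart[of "x - y" 2] by (simp add: dist_norm)
    show "{c..d} \<subseteq> (\<lambda>z. z $ 2) ` (?R i \<inter> ?K)"
    proof
      fix v assume v: "v \<in> {c..d}"
      have "continuous_on {a i..b i} f"
        using cont sub[OF i] by (meson continuous_on_subset le_inf_iff)
      then obtain t where t: "a i \<le> t" "t \<le> b i" "f t = v"
        using IVT'[of f "a i" v "b i"] ab[OF i] v by auto
      then have "graph_point f t \<in> ?R i \<inter> ?K"
        using v sub[OF i] by (auto simp: rectangle_def)
      then show "v \<in> (\<lambda>z. z $ 2) ` (?R i \<inter> ?K)"
        using t by (intro image_eqI[of _ _ "graph_point f t"]) auto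
    qed
  qed
  have "ennreal (card I * (d - c)) = (\<Sum>i\<in>I. ennreal (d - c))"
    using True by (simp add: ennreal_mult ennreal_of_nat_eq_real_of_nat)
  also have "\<dots> \<le> (\<Sum>i\<in>I. emeasure (hausdorff1_restrict ?K) (?R i))"
    using one by (intro sum_mono) (auto simp: emeasure_hausdorff1_restrict)
  also have "\<dots> = emeasure (hausdorff1_restrict ?K) (\<Union>i\<in>I. ?R i)"
  proof (intro sum_emeasure fin)
    show "disjoint_family_on ?R I"
      unfolding disjoint_family_on_def
    proof (intro ballI impI)
      fix i j assume "i \<in> I" "j \<in> I" "i \<noteq> j"
      then have "{a i..b i} \<inter> {a j..b j} = {}" using disj by (simp add: disjoint_family_on_def)
      then have "\<not> (t \<in> {a i..b i} \<and> t \<in> {a j..b j})" for t by blast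
      then show "?R i \<inter> ?R j = {}" unfolding rectangle_def by blast
    qed
  qed auto
  also have "\<dots> \<le> emeasure (hausdorff1_restrict ?K) (rectangle s e c d)"
    using sub by (intro emeasure_mono) (force simp: rectangle_def)+
  finally show ?thesis by (simp add: emeasure_hausdorff1_restrict)
next
  case False
  then have "card I * (d - c) \<le> 0" by (simp add: mult_nonneg_nonpos)
  then show ?thesis by (simp add: ennreal_neg)
qed

section \<open>Jones numbers of a measure that charges three corners of a square\<close>

lemma affine_line_subset_hyperplane:
  assumes "L \<in> affine_lines"
  obtains n :: "real^2" and c where "norm n = 1" "L \<subseteq> {z. n \<bullet> z = c}"
proof -
  have L: "affine L" "aff_dim L = 1" using assms by (auto simp: affine_lines_def)
  then have "aff_dim L = DIM(real^2) - 1" by simp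
  then obtain n b where nb: "n \<noteq> 0" "affine hull L = {z. n \<bullet> z = b}"
    unfolding aff_dim_eq_hyperplane by auto
  have "L \<subseteq> {z. (n /\<^sub>R norm n) \<bullet> z = b / norm n}"
  proof
    fix z assume "z \<in> L"
    then have "n \<bullet> z = b" using nb(2) hull_subset[of L affine] by blast
    then show "z \<in> {z. (n /\<^sub>R norm n) \<bullet> z = b / norm n}" by (simp add: field_simps)
  qed
  then show ?thesis using that[of "n /\<^sub>R norm n" "b / norm n"] nb(1) by simp
qed

lemma infdist_ge_abs_inner:
  assumes "norm n = 1" "L \<subseteq> {z. n \<bullet> z = c}" "L \<noteq> {}"
  shows "\<bar>n \<bullet> y - c\<bar> \<le> infdist y L"
  unfolding infdist_notempty[OF assms(3)]
proof (rule cINF_greatest[OF assms(3)])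
  fix z assume "z \<in> L"
  then have "\<bar>n \<bullet> y - c\<bar> = \<bar>n \<bullet> (y - z)\<bar>" using assms(2) by (auto simp: inner_diff_right)
  also have "\<dots> \<le> dist y z" using Cauchy_Schwarz_ineq2[of n "y - z"] assms(1) by (simp add: dist_norm)
  finally show "\<bar>n \<bullet> y - c\<bar> \<le> dist y z" .
qed

text \<open>Three of the four corners, of a quarter of the side, suffice against all lines.\<close>

definition corners :: "real \<Rightarrow> real \<Rightarrow> real \<Rightarrow> (real^2) set set" where
  "corners a c w = {rectangle a (a + w/4) c (c + w/4),
                    rectangle (a + 3*w/4) (a + w) c (c + w/4),
                    rectangle a (a + w/4) (c + 3*w/4) (c + w)}"

lemma rectangle_mono:
  "a' \<le> a \<Longrightarrow> b \<le> b' \<Longrightarrow> c' \<le> c \<Longrightarrow> d \<le> d' \<Longrightarrow> rectangle a b c d \<subseteq> rectangle a' b' c' d'"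
  by (auto simp: rectangle_def)

lemma corners_subset: "w \<ge> 0 \<Longrightarrow> Q \<in> corners a c w \<Longrightarrow> Q \<subseteq> rectangle a (a + w) c (c + w)"
  unfolding corners_def by (elim insertE emptyE) (simp_all add: rectangle_mono)

lemma sets_corners: "Q \<in> corners a c w \<Longrightarrow> Q \<in> sets borel"
  unfolding corners_def by (elim insertE emptyE) (simp_all only: sets_rectangle)

text \<open>
  A line with unit normal \<open>n\<close> that passes within \<open>w / 16\<close> of a point of each corner makes both
  coordinates of \<open>n\<close> too small for a unit vector: two of the points are far apart horizontally
  and close vertically, which bounds \<open>n $ 1\<close> by about half of \<open>n $ 2\<close>, and two others give the
  same with the coordinates exchanged.
\<close>

lemma line_far_from_corner:
  assumes w: "w > 0" and L: "L \<in> affine_lines"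
  shows "\<exists>Q\<in>corners a c w. \<forall>y\<in>Q. w / 16 \<le> infdist y L"
proof (rule ccontr)
  assume neg: "\<not> ?thesis"
  obtain n :: "real^2" and b where n: "norm n = 1" "L \<subseteq> {z. n \<bullet> z = b}"
    using affine_line_subset_hyperplane[OF L] .
  have "L \<noteq> {}" using L by (auto simp: affine_lines_def)
  note inf = infdist_ge_abs_inner[OF n this]
  obtain x y z where
    x: "x \<in> rectangle a (a + w/4) c (c + w/4)" "infdist x L < w/16" and
    y: "y \<in> rectangle (a + 3*w/4) (a + w) c (c + w/4)" "infdist y L < w/16" and
    z: "z \<in> rectangle a (a + w/4) (c + 3*w/4) (c + w)" "infdist z L < w/16"
    using neg by (force simp: corners_def not_le)
  have ip: "n \<bullet> u = n $ 1 * u $ 1 + n $ 2 * u $ 2" for u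
    by (simp add: inner_vec_def sum_2)
  define p q where "p = \<bar>n $ 1\<bar>" and "q = \<bar>n $ 2\<bar>"
  have "p + q \<ge> 1" using norm_le_l1_cart[of n] n(1) by (simp add: sum_2 p_def q_def)
  have 1: "p * (w/2) < q * (w/4) + w/8"
  proof -
    have "p * (w/2) \<le> p * \<bar>y $ 1 - x $ 1\<bar>"
      using x(1) y(1) by (intro mult_left_mono) (auto simp: rectangle_def p_def)
    also have "\<dots> = \<bar>(n \<bullet> y - b) - (n \<bullet> x - b) - n $ 2 * (y $ 2 - x $ 2)\<bar>"
      by (simp add: ip p_def abs_mult[symmetric] algebra_simps)
    also have "\<dots> \<le> \<bar>n \<bullet> y - b\<bar> + \<bar>n \<bullet> x - b\<bar> + q * \<bar>y $ 2 - x $ 2\<bar>"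
      unfolding q_def abs_mult[symmetric] by linarith
    also have "\<dots> \<le> \<bar>n \<bullet> y - b\<bar> + \<bar>n \<bullet> x - b\<bar> + q * (w/4)"
      using x(1) y(1) by (intro add_left_mono mult_left_mono abs_leI)
        (auto simp: rectangle_def q_def)
    also have "\<dots> < w/8 + q * (w/4)"
      using inf[of x] inf[of y] x(2) y(2) by linarith
    finally show ?thesis by simp
  qed
  have 2: "q * (w/2) < p * (w/4) + w/8"
  proof -
    have "q * (w/2) \<le> q * \<bar>z $ 2 - x $ 2\<bar>"
      using x(1) z(1) by (intro mult_left_mono) (auto simp: rectangle_def q_def)
    also have "\<dots> = \<bar>(n \<bullet> z - b) - (n \<bullet> x - b) - n $ 1 * (z $ 1 - x $ 1)\<bar>"
      by (simp add: ip q_def abs_mult[symmetric] algebra_simps)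
    also have "\<dots> \<le> \<bar>n \<bullet> z - b\<bar> + \<bar>n \<bullet> x - b\<bar> + p * \<bar>z $ 1 - x $ 1\<bar>"
      unfolding p_def abs_mult[symmetric] by linarith
    also have "\<dots> \<le> \<bar>n \<bullet> z - b\<bar> + \<bar>n \<bullet> x - b\<bar> + p * (w/4)"
      using x(1) z(1) by (intro add_left_mono mult_left_mono abs_leI)
        (auto simp: rectangle_def p_def)
    also have "\<dots> < w/8 + p * (w/4)"
      using inf[of x] inf[of z] x(2) z(2) by linarith
    finally show ?thesis by simp
  qed
  have "(p + q) * (w/4) < 1 * (w/4)"
    using 1 2 by (simp add: algebra_simps)
  then have "p + q < 1" using w by (simp only: mult_less_cancel_right)
  then show False using \<open>p + q \<ge> 1\<close> by simp
qed

lemma ennreal_sqrt_square [simp]: "(ennreal_sqrt x)\<^sup>2 = x"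
proof (cases x)
  case (real r)
  then show ?thesis by (simp add: ennreal_sqrt_def ennreal_power)
qed (simp add: ennreal_sqrt_def)

text \<open>
  The ball contains the square, and for every line one of the corners, of measure at least \<open>m\<close>,
  is at distance at least \<open>w / 16\<close>. The constant is
  \<open>(w / 16 / (4 * w))\<^sup>2 / (4 * w) = 1 / (2 ^ 14 * w)\<close>.
\<close>

lemma jones_beta_corners:
  assumes w: "w > 0" and sets: "sets \<mu> = sets borel" and m: "m \<ge> 0"
    and mass: "\<And>Q. Q \<in> corners a c w \<Longrightarrow> ennreal m \<le> emeasure \<mu> Q"
    and y: "y \<in> rectangle a (a + w) c (c + w)" and r: "2 * w < r" "r < 4 * w"
  shows "ennreal (m / (2^14 * w)) \<le> (jones_beta \<mu> y r)\<^sup>2"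
  unfolding jones_beta_def ennreal_sqrt_square
proof (rule INF_greatest)
  fix L :: "(real^2) set" assume "L \<in> affine_lines"
  then obtain Q where Q: "Q \<in> corners a c w" "\<And>z. z \<in> Q \<Longrightarrow> w / 16 \<le> infdist z L"
    using line_far_from_corner[OF w] by blast
  have "Q \<subseteq> rectangle a (a + w) c (c + w)"
    using Q(1) corners_subset[of w Q a c] w by auto
  have in_ball: "z \<in> ball y r" if "z \<in> Q" for z
  proof -
    have "z \<in> rectangle a (a + w) c (c + w)" using that \<open>Q \<subseteq> _\<close> by blast
    then have "\<bar>y $ 1 - z $ 1\<bar> \<le> w" "\<bar>y $ 2 - z $ 2\<bar> \<le> w"
      using y by (auto simp: rectangle_def)
    then show ?thesis using dist_le_sum_abs_2[of y z] r by simp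
  qed
  have "1 / (2^14 * w) \<le> (infdist z L / r)^2 / r" if "z \<in> Q" for z
  proof -
    have "1 / (2^14 * w) = (w/16 / (4*w))^2 / (4*w)"
      using w by (simp add: power_divide)
    also have "\<dots> \<le> (infdist z L / r)^2 / r"
      using w r that Q(2)[OF that] by (intro frac_le power_mono divide_nonneg_nonneg) auto
    finally show ?thesis .
  qed
  then have dist: "ennreal (1 / (2^14 * w)) \<le> ennreal ((infdist z L / r)^2 / r)" if "z \<in> Q" for z
    using that by (intro ennreal_leI)
  have pt: "ennreal (1 / (2^14 * w)) * indicator Q z
      \<le> ennreal ((infdist z L / r)^2 / r) * indicator (ball y r) z" for z
  proof (cases "z \<in> Q")
    case True
    then show ?thesis
      using dist[OF True] in_ball[OF True] by (simp only: indicator_simps mult_1_right)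
  next
    case False
    then show ?thesis by (simp add: indicator_def)
  qed
  have "Q \<in> sets \<mu>" unfolding sets using Q(1) by (rule sets_corners)
  have "ennreal (m / (2^14 * w)) = ennreal (1 / (2^14 * w)) * ennreal m"
    using w m by (simp add: ennreal_mult[symmetric])
  also have "\<dots> \<le> ennreal (1 / (2^14 * w)) * emeasure \<mu> Q"
    using mass[OF Q(1)] by (rule mult_left_mono) simp
  also have "\<dots> = (\<integral>\<^sup>+z. ennreal (1 / (2^14 * w)) * indicator Q z \<partial>\<mu>)"
    using \<open>Q \<in> sets \<mu>\<close> by (simp add: nn_integral_cmult_indicator)
  also have "\<dots> \<le> (\<integral>\<^sup>+z\<in>ball y r. ennreal ((infdist z L / r)^2 / r) \<partial>\<mu>)"
    by (intro nn_integral_mono pt)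
  finally show "ennreal (m / (2^14 * w)) \<le> (\<integral>\<^sup>+z\<in>ball y r. ennreal ((infdist z L / r)^2 / r) \<partial>\<mu>)" .
qed

text \<open>
  The mass enters twice: once through the Jones number and once through the points \<open>y\<close> at which
  it is large. The radii between \<open>2 * w\<close> and \<open>4 * w\<close> alone contribute at least \<open>1/2\<close> to the
  integral of \<open>1 / r\<close>.
\<close>

lemma square_function_corners:
  assumes w: "w > 0" and sets: "sets \<mu> = sets borel" and m: "m \<ge> 0"
    and mass: "\<And>Q. Q \<in> corners a c w \<Longrightarrow> ennreal m \<le> emeasure \<mu> Q"
    and \<delta>: "4 * w \<le> \<delta>"
    and S: "S \<in> sets borel" "S \<subseteq> ball x \<delta>" "S \<subseteq> rectangle a (a + w) c (c + w)"
      "ennreal m \<le> emeasure \<mu> S"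
  shows "ennreal (m^2 / (2^15 * w)) \<le>
    (\<integral>\<^sup>+y\<in>ball x \<delta>. (\<integral>\<^sup>+r\<in>{0<..<\<delta>}. (jones_beta \<mu> y r)^2 * ennreal (1 / r) \<partial>lborel) \<partial>\<mu>)"
proof -
  have inner: "ennreal (m / (2^15 * w)) \<le>
      (\<integral>\<^sup>+r\<in>{0<..<\<delta>}. (jones_beta \<mu> y r)^2 * ennreal (1 / r) \<partial>lborel)" if "y \<in> S" for y
  proof -
    have pt: "ennreal (m / (2^14 * w) * (1 / (4 * w))) * indicator {2*w<..<4*w} r \<le>
        (jones_beta \<mu> y r)^2 * ennreal (1 / r) * indicator {0<..<\<delta>} r" for r
    proof (cases "r \<in> {2*w<..<4*w}")
      case True
      then have "ennreal (m / (2^14 * w)) \<le> (jones_beta \<mu> y r)\<^sup>2"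
        using that S by (intro jones_beta_corners[OF w sets m mass]) auto
      moreover have "ennreal (1 / (4 * w)) \<le> ennreal (1 / r)"
        using True w by (intro ennreal_leI divide_left_mono) auto
      ultimately have "ennreal (m / (2^14 * w)) * ennreal (1 / (4 * w)) \<le>
          (jones_beta \<mu> y r)\<^sup>2 * ennreal (1 / r)"
        by (intro mult_mono) auto
      moreover have "ennreal (m / (2^14 * w)) * ennreal (1 / (4 * w)) =
          ennreal (m / (2^14 * w) * (1 / (4 * w)))"
        using w m by (intro ennreal_mult[symmetric]) auto
      moreover have "r \<in> {0<..<\<delta>}" using True w \<delta> by auto
      ultimately show ?thesis using True by simp
    qed simp
    have "ennreal (m / (2^15 * w)) = ennreal (m / (2^14 * w) * (1 / (4 * w))) * ennreal (2 * w)"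
      using w m by (simp add: ennreal_mult[symmetric] field_simps)
    also have "\<dots> = (\<integral>\<^sup>+r. ennreal (m / (2^14 * w) * (1 / (4 * w))) * indicator {2*w<..<4*w} r \<partial>lborel)"
      using w by (subst nn_integral_cmult_indicator) auto
    also have "\<dots> \<le> (\<integral>\<^sup>+r\<in>{0<..<\<delta>}. (jones_beta \<mu> y r)^2 * ennreal (1 / r) \<partial>lborel)"
      by (intro nn_integral_mono pt)
    finally show ?thesis .
  qed
  have "ennreal (m^2 / (2^15 * w)) = ennreal (m / (2^15 * w)) * ennreal m"
    using w m by (simp add: ennreal_mult[symmetric] power2_eq_square)
  also have "\<dots> \<le> ennreal (m / (2^15 * w)) * emeasure \<mu> S"
    using S by (intro mult_left_mono) auto
  also have "\<dots> = (\<integral>\<^sup>+y. ennreal (m / (2^15 * w)) * indicator S y \<partial>\<mu>)"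
    using S sets by (simp add: nn_integral_cmult_indicator)
  also have "\<dots> \<le> (\<integral>\<^sup>+y\<in>ball x \<delta>. (\<integral>\<^sup>+r\<in>{0<..<\<delta>}. (jones_beta \<mu> y r)^2 * ennreal (1 / r) \<partial>lborel) \<partial>\<mu>)"
    using S inner by (intro nn_integral_mono) (auto simp: indicator_def)
  finally show ?thesis .
qed

text \<open>The increments of \<open>V\<close> dominate the chords of the curve and telescope over a partition.\<close>

lemma curve_length_le:
  assumes "a \<le> b" and V: "\<And>s t. a \<le> s \<Longrightarrow> s \<le> t \<Longrightarrow> t \<le> b \<Longrightarrow> dist (g s) (g t) \<le> V t - V s"
  shows "curve_length g a b \<le> ennreal (V b - V a)"
  unfolding curve_length_def
proof (rule SUP_least, clarify)
  fix n :: nat and t :: "nat \<Rightarrow> real"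
  assume mono: "mono_on {..n} t" and t: "t ` {..n} \<subseteq> {a..b}"
  have Vmono: "V s \<le> V r" if "a \<le> s" "s \<le> r" "r \<le> b" for s r
    using V[OF that] zero_le_dist[of "g s" "g r"] by linarith
  have t': "a \<le> t i" "t i \<le> b" if "i \<le> n" for i
    using t that by (auto simp: image_subset_iff)
  have "(\<Sum>i<n. ennreal (dist (g (t i)) (g (t (Suc i))))) = ennreal (\<Sum>i<n. dist (g (t i)) (g (t (Suc i))))"
    by (intro sum_ennreal) simp
  also have "\<dots> \<le> ennreal (\<Sum>i<n. V (t (Suc i)) - V (t i))"
    using t' mono by (intro ennreal_leI sum_mono V) (auto simp: mono_on_def)
  also have "\<dots> = ennreal (V (t n) - V (t 0))"
    using sum_lessThan_telescope[of "\<lambda>i. V (t i)" n] by simp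
  also have "\<dots> \<le> ennreal (V b - V a)"
    using Vmono[of a "t 0"] Vmono[of "t n" b] t'[of 0] t'[of n] by (intro ennreal_leI) auto
  finally show "(\<Sum>i<n. ennreal (dist (g (t i)) (g (t (Suc i))))) \<le> ennreal (V b - V a)" .
qed

section \<open>An oscillating function of bounded variation\<close>

lemma abs_sin_squared_diff_le: "\<bar>(sin x)\<^sup>2 - (sin y)\<^sup>2\<bar> \<le> \<bar>x - y\<bar>" for x y :: real
proof -
  have "(sin x)\<^sup>2 - (sin y)\<^sup>2 = sin (x + y) * sin (x - y)"
  proof -
    have "sin (x + y) * sin (x - y) = (sin x)\<^sup>2 * (cos y)\<^sup>2 - (cos x)\<^sup>2 * (sin y)\<^sup>2"
      unfolding sin_add sin_diff by (simp add: algebra_simps power2_eq_square)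
    also have "\<dots> = (sin x)\<^sup>2 - (sin y)\<^sup>2"
      unfolding cos_squared_eq by (simp add: algebra_simps)
    finally show ?thesis by simp
  qed
  then have "\<bar>(sin x)\<^sup>2 - (sin y)\<^sup>2\<bar> = \<bar>sin (x + y)\<bar> * \<bar>sin (x - y)\<bar>" by (simp add: abs_mult)
  also have "\<dots> \<le> 1 * \<bar>x - y\<bar>"
    by (intro mult_mono abs_sin_x_le_abs_x abs_sin_le_one) auto
  finally show ?thesis by simp
qed

text \<open>
  The \<open>k\<close>-th oscillation takes place over \<open>{site k..site k + width k}\<close>. There it makes
  \<open>turns k\<close> oscillations of amplitude \<open>height k\<close>, all of it measured by one rapidly
  decreasing sequence \<open>u = cluster_scale k\<close>: height \<open>u ^ 5\<close>, width \<open>u ^ 8\<close>, and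
  \<open>2 ^ (- k) * u powr (-5)\<close> turns. These exponents meet the following four demands.

  \<^item> The variation \<open>2 * turns k * height k\<close> is summable: it is \<open>2 * 2 ^ (- k)\<close>.
  \<^item> The square of side \<open>width k\<close> yields \<open>(turns k)\<^sup>2 * width k = 4 ^ (- k) / u\<^sup>2\<close>, which is
    unbounded.
  \<^item> The earlier oscillations are almost constant over \<open>{site k..site k + width k}\<close>, compared to
    \<open>height k\<close>. Their slopes are at most of the order of
    \<open>1 / width (k - 1) = 1 / cluster_scale (k - 1) ^ 8 = 1 / u\<^sup>2\<close>, so they change by at most a
    constant times \<open>u ^ 6\<close>. This is where \<open>cluster_scale (k + 1) = cluster_scale k ^ 4\<close>
    is used.
  \<^item> The amplitudes of the later oscillations add up to little compared to \<open>height k\<close>.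
\<close>

definition cluster_scale :: "nat \<Rightarrow> real" where
  "cluster_scale k = (1/2) ^ (4 ^ (k + 2))"

definition height :: "nat \<Rightarrow> real" where
  "height k = cluster_scale k ^ 5"

definition width :: "nat \<Rightarrow> real" where
  "width k = cluster_scale k ^ 8"

definition turns :: "nat \<Rightarrow> nat" where
  "turns k = 2 ^ (5 * 4 ^ (k + 2) - k)"

text \<open>
  Decoding \<open>k\<close> as a pair makes every rational number occur as \<open>site k\<close> for infinitely many
  \<open>k\<close>, so that every interval contains sites of clusters of arbitrarily small scale.
\<close>

definition site :: "nat \<Rightarrow> real" where
  "site k = from_nat_into \<rat> (fst (prod_decode k))"

text \<open>
  The number of oscillations performed up to \<open>t\<close>. Freezing the argument of the sine outside
  the cluster, instead of cutting off the oscillation, keeps the phase monotone. The variation of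
  \<open>wiggle k\<close> is then bounded by a multiple of the total increase \<open>turns k\<close> of the phase.
\<close>

definition phase :: "nat \<Rightarrow> real \<Rightarrow> real" where
  "phase k t = max 0 (min (real (turns k)) (real (turns k) * (t - site k) / width k))"

definition wiggle :: "nat \<Rightarrow> real \<Rightarrow> real" where
  "wiggle k t = height k * (sin (pi * phase k t))\<^sup>2"

definition profile :: "real \<Rightarrow> real" where
  "profile t = (\<Sum>k. wiggle k t)"

lemma less_four_power: "k < (4::nat) ^ k"
  by (rule less_le_trans[OF less_exp power_mono]) auto

lemma cluster_scale_pos [simp]: "cluster_scale k > 0" by (simp add: cluster_scale_def)

lemma cluster_scale_nonneg [simp]: "cluster_scale k \<ge> 0" and cluster_scale_nonzero [simp]: "cluster_scale k \<noteq> 0"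
  using cluster_scale_pos[of k] by linarith+

lemma cluster_scale_Suc: "cluster_scale (Suc k) = cluster_scale k ^ 4"
  by (simp add: cluster_scale_def power_mult[symmetric] mult.commute)

lemma cluster_scale_le: "cluster_scale k \<le> 1/64" "cluster_scale k \<le> (1/4) ^ k"
proof -
  have "(4::nat) ^ 2 \<le> 4 ^ (k + 2)" by (rule power_increasing) auto
  then have "6 \<le> (4::nat) ^ (k + 2)" unfolding power2_eq_square by linarith
  then have "cluster_scale k \<le> (1/2) ^ 6" unfolding cluster_scale_def by (rule power_decreasing) auto
  then show "cluster_scale k \<le> 1/64" by (simp add: power_divide)
  have "2 * k \<le> (4::nat) ^ (k + 2)" using less_four_power[of k] by simp
  then have "cluster_scale k \<le> (1/2) ^ (2 * k)" unfolding cluster_scale_def by (rule power_decreasing) auto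
  then show "cluster_scale k \<le> (1/4) ^ k" by (simp add: power_mult power_divide)
qed

lemma cluster_scale_antimono: "j \<le> k \<Longrightarrow> cluster_scale k \<le> cluster_scale j"
  unfolding cluster_scale_def by (intro power_decreasing power_increasing) auto

lemma height_pos [simp]: "height k > 0" and width_pos [simp]: "width k > 0"
  and turns_pos [simp]: "turns k > 0"
  by (simp_all add: height_def width_def turns_def)

lemma height_nonneg [simp]: "height k \<ge> 0" and width_nonneg [simp]: "width k \<ge> 0"
  and width_nonzero [simp]: "width k \<noteq> 0" and turns_nonzero [simp]: "turns k \<noteq> 0"
  using height_pos[of k] width_pos[of k] turns_pos[of k] by linarith+

lemma turns_height: "real (turns k) * height k = (1/2) ^ k"
proof -
  have "k \<le> 5 * 4 ^ (k + 2)" using less_four_power[of k] by simp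
  then have "real (turns k) = 2 ^ (5 * 4 ^ (k + 2)) / 2 ^ k"
    unfolding turns_def of_nat_power of_nat_numeral by (intro power_diff) auto
  moreover have "height k = 1 / 2 ^ (5 * 4 ^ (k + 2))"
    unfolding height_def cluster_scale_def power_mult[symmetric]
    by (simp only: power_one_over mult.commute[of 5])
  ultimately show ?thesis by (simp add: power_divide)
qed

lemma four_dvd_turns: "4 dvd turns k"
proof -
  have "k + 2 \<le> 5 * 4 ^ (k + 2)" using less_four_power[of k] by simp
  then have "2 \<le> 5 * 4 ^ (k + 2) - k" by simp
  then have "(2::nat) ^ 2 dvd turns k" unfolding turns_def by (rule le_imp_power_dvd)
  then show ?thesis by simp
qed

lemma height_le: "height k \<le> (1/2) ^ k"
proof -
  have "1 * height k \<le> real (turns k) * height k"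
    using turns_pos[of k] by (intro mult_right_mono) (auto simp del: turns_pos)
  then show ?thesis using turns_height[of k] by simp
qed

lemma width_le: "width k \<le> height k / 2" "width k \<le> cluster_scale k"
proof -
  have "cluster_scale k ^ 3 \<le> (1/64) ^ 3" by (intro power_mono cluster_scale_le) (simp add: less_imp_le)
  then have "height k * cluster_scale k ^ 3 \<le> height k * (1/2)"
    by (intro mult_left_mono) (auto simp: less_imp_le power_divide)
  then show "width k \<le> height k / 2"
    by (simp add: width_def height_def power_add[symmetric])
  show "width k \<le> cluster_scale k"
    using cluster_scale_le(1)[of k] power_decreasing[of 1 8 "cluster_scale k"] by (simp add: width_def less_imp_le)
qed

lemma turns_squared_width: "2 ^ k \<le> (real (turns k))\<^sup>2 * width k"
proof -
  have "(real (turns k))\<^sup>2 * width k * (cluster_scale k)\<^sup>2 = (real (turns k) * height k)\<^sup>2"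
    by (simp add: width_def height_def power_mult_distrib power_add[symmetric] power_mult[symmetric])
  also have "\<dots> = ((1/2)\<^sup>2) ^ k"
    unfolding turns_height by (simp only: power_mult[symmetric] mult.commute)
  also have "\<dots> = (1/4) ^ k" by (simp add: power_divide)
  finally have "(real (turns k))\<^sup>2 * width k = (1/4) ^ k / (cluster_scale k)\<^sup>2"
    by (simp add: eq_divide_eq)
  also have "\<dots> \<ge> (1/4) ^ k / ((1/4) ^ k)\<^sup>2"
    by (intro divide_left_mono power_mono cluster_scale_le) (auto simp: less_imp_le)
  also have "(1/4) ^ k / ((1/4) ^ k)\<^sup>2 = (4 ^ k :: real)"
    by (simp add: power2_eq_square power_divide)
  also have "(4::real) ^ k \<ge> 2 ^ k" by (rule power_mono) auto
  finally show ?thesis by simp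
qed

lemma summable_height: "summable height"
  by (rule summable_comparison_test'[where g="\<lambda>k. (1/2) ^ k" and N=0])
    (auto simp: height_le less_imp_le summable_geometric)

lemma suminf_later_heights: "(\<Sum>i. height (i + Suc k)) \<le> height k / 8"
proof -
  have step: "height (Suc n) \<le> height n / 16" for n
  proof -
    have "cluster_scale n ^ 15 \<le> (1/64) ^ 15" by (intro power_mono cluster_scale_le) (simp add: less_imp_le)
    also have "\<dots> \<le> (1/16 :: real)" by (simp add: power_divide)
    finally have "height n * cluster_scale n ^ 15 \<le> height n * (1/16)"
      by (intro mult_left_mono) (auto simp: less_imp_le)
    then show ?thesis by (simp add: height_def cluster_scale_Suc power_add[symmetric] power_mult[symmetric])
  qed
  have le: "height (i + Suc k) \<le> height k / 16 * (1/2) ^ i" for i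
  proof (induction i)
    case 0
    then show ?case using step[of k] by simp
  next
    case (Suc i)
    have "height (Suc i + Suc k) \<le> height (i + Suc k) / 2"
      using step[of "i + Suc k"] height_pos[of "i + Suc k"] unfolding add_Suc by linarith
    then show ?case using Suc.IH by simp
  qed
  have geom: "(\<lambda>i. height k / 16 * (1/2) ^ i) sums (height k / 16 * (1 / (1 - 1/2)))"
    by (intro sums_mult geometric_sums) simp
  have "(\<lambda>i. height (i + Suc k)) sums (\<Sum>i. height (i + Suc k))"
    by (rule summable_sums[OF summable_ignore_initial_segment[OF summable_height]])
  from sums_le[OF le this geom] show ?thesis by simp
qed

lemma phase_bounds: "0 \<le> phase k t" "phase k t \<le> turns k"
  by (auto simp: phase_def)

lemma phase_mono: "s \<le> t \<Longrightarrow> phase k s \<le> phase k t"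
  unfolding phase_def
  by (intro max.mono min.mono divide_right_mono mult_left_mono) (auto simp: less_imp_le)

lemma phase_diff_le:
  assumes "s \<le> t"
  shows "phase k t - phase k s \<le> real (turns k) * (t - s) / width k"
proof -
  define x where "x s = real (turns k) * (s - site k) / width k" for s
  have "x s \<le> x t" unfolding x_def using assms by (intro divide_right_mono mult_left_mono) auto
  moreover have "x t - x s = real (turns k) * (t - s) / width k"
    by (simp add: x_def diff_divide_distrib[symmetric] algebra_simps)
  ultimately show ?thesis unfolding phase_def x_def[symmetric] by (auto simp: max_def min_def)
qed

lemma wiggle_bounds: "0 \<le> wiggle k t" "wiggle k t \<le> height k"
  by (simp_all add: wiggle_def less_imp_le mult_left_le[OF _ less_imp_le] abs_square_le_1)

lemma wiggle_diff_le:
  assumes "s \<le> t"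
  shows "\<bar>wiggle k t - wiggle k s\<bar> \<le> 4 * height k * (phase k t - phase k s)"
proof -
  have "\<bar>wiggle k t - wiggle k s\<bar> =
      height k * \<bar>(sin (pi * phase k t))\<^sup>2 - (sin (pi * phase k s))\<^sup>2\<bar>"
    using height_pos[of k] by (simp add: wiggle_def abs_mult right_diff_distrib[symmetric])
  also have "\<dots> \<le> height k * \<bar>pi * phase k t - pi * phase k s\<bar>"
    by (intro mult_left_mono abs_sin_squared_diff_le) (simp add: less_imp_le)
  also have "\<dots> = height k * (pi * (phase k t - phase k s))"
    using phase_mono[OF assms, of k] by (simp add: abs_mult right_diff_distrib[symmetric])
  also have "\<dots> \<le> height k * (4 * (phase k t - phase k s))"
    using phase_mono[OF assms, of k] pi_less_4
    by (intro mult_left_mono mult_right_mono) (auto simp: less_imp_le)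
  finally show ?thesis by (simp only: mult_ac)
qed

lemma summable_wiggle: "summable (\<lambda>k. wiggle k t)"
  by (rule summable_comparison_test'[OF summable_height, where N=0])
    (auto simp: wiggle_bounds)

lemma continuous_on_profile: "continuous_on A profile"
proof (rule uniform_limit_theorem)
  show "uniform_limit A (\<lambda>n t. \<Sum>k<n. wiggle k t) profile sequentially"
    unfolding profile_def
    by (rule Weierstrass_m_test[OF _ summable_height]) (auto simp: wiggle_bounds)
  show "\<forall>\<^sub>F n in sequentially. continuous_on A (\<lambda>t. \<Sum>k<n. wiggle k t)"
    unfolding wiggle_def phase_def
    by (intro always_eventually allI continuous_intros) auto
qed simp

text \<open>
  The increments of \<^const>\<open>profile\<close> are dominated by those of the monotone function
  \<open>\<lambda>t. \<Sum>k. 4 * height k * phase k t\<close>, and this is bounded because the products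
  \<open>height k * turns k = 2 ^ (- k)\<close> are summable.
\<close>

lemma rectifiable_profile_graph: "rectifiable_curve (graph_point profile ` {0..1})"
proof -
  define V where "V t = t + (\<Sum>k. 4 * height k * phase k t)" for t
  have summ: "summable (\<lambda>k. 4 * height k * phase k t)" for t
  proof (rule summable_comparison_test'[where g="\<lambda>k. 4 * (1/2) ^ k" and N=0])
    fix k
    have "height k * phase k t \<le> height k * turns k"
      by (intro mult_left_mono phase_bounds height_nonneg)
    also have "\<dots> = (1/2) ^ k" using turns_height[of k] by (simp only: mult.commute)
    finally have "height k * phase k t \<le> (1/2) ^ k" .
    moreover have "norm (4 * height k * phase k t) = 4 * (height k * phase k t)"
    proof -
      have "0 \<le> 4 * height k * phase k t"
        by (intro mult_nonneg_nonneg phase_bounds height_nonneg) simp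
      then show ?thesis by (simp only: real_norm_def abs_of_nonneg mult.assoc)
    qed
    ultimately show "norm (4 * height k * phase k t) \<le> 4 * (1/2) ^ k" by linarith
  qed (simp add: summable_geometric)
  have "dist (graph_point profile s) (graph_point profile t) \<le> V t - V s" if "s \<le> t" for s t
  proof -
    have le: "\<bar>wiggle k t - wiggle k s\<bar> \<le> 4 * height k * phase k t - 4 * height k * phase k s" for k
      using wiggle_diff_le[OF that, of k] by (simp only: right_diff_distrib)
    have summ': "summable (\<lambda>k. \<bar>wiggle k t - wiggle k s\<bar>)"
      by (rule summable_comparison_test'[OF summable_diff[OF summ[of t] summ[of s]], of 0])
        (simp only: real_norm_def abs_abs le)
    have "\<bar>profile t - profile s\<bar> = \<bar>\<Sum>k. wiggle k t - wiggle k s\<bar>"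
      unfolding profile_def by (simp add: suminf_diff summable_wiggle)
    also have "\<dots> \<le> (\<Sum>k. \<bar>wiggle k t - wiggle k s\<bar>)"
      by (rule summable_rabs[OF summ'])
    also have "\<dots> \<le> (\<Sum>k. 4 * height k * phase k t - 4 * height k * phase k s)"
      by (intro suminf_le le summ' summable_diff summ)
    also have "\<dots> = (\<Sum>k. 4 * height k * phase k t) - (\<Sum>k. 4 * height k * phase k s)"
      by (simp add: suminf_diff summ)
    finally have "\<bar>profile t - profile s\<bar> \<le> \<dots>" .
    moreover have "dist (graph_point profile s) (graph_point profile t) \<le>
        \<bar>s - t\<bar> + \<bar>profile s - profile t\<bar>"
      using dist_le_sum_abs_2[of "graph_point profile s" "graph_point profile t"] by simp
    ultimately show ?thesis using that by (simp add: V_def abs_minus_commute)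
  qed
  then have "curve_length (graph_point profile) 0 1 \<le> ennreal (V 1 - V 0)"
    by (intro curve_length_le) auto
  then have "curve_length (graph_point profile) 0 1 < \<infinity>"
    by (simp add: le_less_trans)
  then show ?thesis
    unfolding rectifiable_curve_def
    using continuous_on_graph_point[OF continuous_on_profile]
    by (intro exI[of _ "graph_point profile"] exI[of _ 0] exI[of _ 1]) auto
qed

text \<open>
  For \<open>j < k\<close> the slope of \<open>wiggle j\<close> is at most
  \<open>4 * height j * turns j / width j = 4 * 2 ^ (- j) / width j\<close>, and \<open>width j\<close> is at least
  \<open>(cluster_scale k)\<^sup>2\<close>.
\<close>

lemma sum_earlier_wiggles_diff_le:
  assumes "site k \<le> t" "t \<le> site k + width k"
  shows "\<bar>(\<Sum>j<k. wiggle j t) - (\<Sum>j<k. wiggle j (site k))\<bar> \<le> height k / 8"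
proof -
  have "\<bar>wiggle j t - wiggle j (site k)\<bar> \<le> 4 * cluster_scale k ^ 6 * (1/2) ^ j" if "j < k" for j
  proof -
    have "\<bar>wiggle j t - wiggle j (site k)\<bar> \<le> 4 * height j * (phase j t - phase j (site k))"
      by (rule wiggle_diff_le[OF assms(1)])
    also have "\<dots> \<le> 4 * height j * (real (turns j) * (t - site k) / width j)"
      by (intro mult_left_mono phase_diff_le assms) (simp add: less_imp_le)
    also have "\<dots> = 4 * (turns j * height j) * ((t - site k) / width j)"
      by simp
    also have "\<dots> = 4 * (1/2) ^ j * ((t - site k) / width j)"
      unfolding turns_height ..
    also have "\<dots> \<le> 4 * (1/2) ^ j * (width k / (cluster_scale k)\<^sup>2)"
    proof (intro mult_left_mono frac_le)
      have "cluster_scale k \<le> cluster_scale j ^ 4"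
        using cluster_scale_antimono[of "Suc j" k] that by (simp add: cluster_scale_Suc)
      then have "(cluster_scale k)\<^sup>2 \<le> (cluster_scale j ^ 4)\<^sup>2"
        by (intro power_mono) (auto simp: less_imp_le)
      then show "(cluster_scale k)\<^sup>2 \<le> width j" by (simp add: width_def power_mult[symmetric])
    qed (use assms in \<open>auto simp: less_imp_le\<close>)
    also have "width k / (cluster_scale k)\<^sup>2 = cluster_scale k ^ 6"
      by (simp add: width_def power_diff[symmetric])
    finally show ?thesis by (simp add: mult_ac)
  qed
  then have "\<bar>(\<Sum>j<k. wiggle j t) - (\<Sum>j<k. wiggle j (site k))\<bar> \<le> (\<Sum>j<k. 4 * cluster_scale k ^ 6 * (1/2) ^ j)"
    unfolding sum_subtractf[symmetric] by (intro order_trans[OF sum_abs] sum_mono) auto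
  also have "\<dots> = 4 * cluster_scale k ^ 6 * (\<Sum>j<k. (1/2) ^ j)"
    by (simp add: sum_distrib_left)
  also have "\<dots> \<le> 4 * cluster_scale k ^ 6 * (\<Sum>j. (1/2) ^ j)"
    by (intro mult_left_mono sum_le_suminf summable_geometric) (auto simp: less_imp_le)
  also have "\<dots> = 8 * cluster_scale k ^ 6" by (simp add: suminf_geometric)
  also have "\<dots> = 8 * cluster_scale k ^ 5 * cluster_scale k" by (simp add: power_Suc2[symmetric])
  also have "\<dots> \<le> 8 * cluster_scale k ^ 5 * (1/64)"
    by (intro mult_left_mono cluster_scale_le) (auto simp: less_imp_le)
  finally show ?thesis by (simp add: height_def)
qed

text \<open>
  Over its own interval the \<open>k\<close>-th oscillation dominates: up to an error that is small
  compared to \<open>height k\<close>, the profile is a constant plus \<open>wiggle k\<close>. The lower bound has the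
  smaller error because the later oscillations are nonnegative.
\<close>

lemma profile_near_wiggle:
  assumes "site k \<le> t" "t \<le> site k + width k"
  defines "b \<equiv> (\<Sum>j<k. wiggle j (site k))"
  shows "profile t \<le> b + wiggle k t + height k / 4" "b + wiggle k t - height k / 8 \<le> profile t"
proof -
  have summ: "summable (\<lambda>i. wiggle (i + Suc k) t)"
    using summable_wiggle summable_ignore_initial_segment by blast
  have hs: "summable (\<lambda>i. height (i + Suc k))"
    using summable_height summable_ignore_initial_segment by blast
  have "profile t = (\<Sum>i. wiggle (i + Suc k) t) + ((\<Sum>j<k. wiggle j t) + wiggle k t)"
    unfolding profile_def
    by (subst suminf_split_initial_segment[OF summable_wiggle, of _ "Suc k"]) simp
  moreover have "0 \<le> (\<Sum>i. wiggle (i + Suc k) t)"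
    by (intro suminf_nonneg summ wiggle_bounds)
  moreover have "(\<Sum>i. wiggle (i + Suc k) t) \<le> (\<Sum>i. height (i + Suc k))"
    by (intro suminf_le summ hs wiggle_bounds)
  moreover have "(\<Sum>i. height (i + Suc k)) \<le> height k / 8"
    by (rule suminf_later_heights)
  moreover have "\<bar>(\<Sum>j<k. wiggle j t) - b\<bar> \<le> height k / 8"
    unfolding b_def by (rule sum_earlier_wiggles_diff_le[OF assms(1,2)])
  ultimately show "profile t \<le> b + wiggle k t + height k / 4"
    "b + wiggle k t - height k / 8 \<le> profile t"
    by linarith+
qed

section \<open>The length of the graph inside a cluster\<close>

lemma phase_in_cluster:
  fixes x :: real
  assumes "0 \<le> x" "x \<le> turns k"
  shows "phase k (site k + x * width k / turns k) = x"
  using assms by (simp add: phase_def)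

text \<open>
  Between the phases \<open>i\<close> and \<open>i + 1/2\<close> the oscillation rises from \<open>0\<close> to
  \<open>height k\<close>. The errors allowed by \<open>profile_near_wiggle\<close> leave the range between
  \<open>b + height k / 4\<close> and \<open>b + 7 * height k / 8\<close>, so the profile still crosses every strip
  \<open>c \<le> y \<le> d\<close> inside it. The phase \<open>i + 1/2\<close> is less than \<open>i + 1\<close>, which keeps the
  intervals of different crossings disjoint.
\<close>

lemma hausdorff1_cluster_columns:
  assumes T: "{site k..site k + width k} \<subseteq> T" and l: "l + m \<le> turns k"
  defines "b \<equiv> (\<Sum>j<k. wiggle j (site k))"
  assumes cd: "b + height k / 4 \<le> c" "d \<le> b + 3 * height k / 4"
    and s: "s \<le> site k + l * width k / turns k" and e: "site k + (l + m) * width k / turns k \<le> e"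
  shows "ennreal (m * (d - c)) \<le> hausdorff1 (rectangle s e c d \<inter> graph_point profile ` T)"
proof -
  define col where "col x = site k + x * width k / turns k" for x :: real
  have col_mono: "col x \<le> col y" if "x \<le> y" for x y
    using that unfolding col_def by (intro add_left_mono divide_right_mono mult_right_mono) auto
  have col_less: "col x < col y \<longleftrightarrow> x < y" for x y
    using turns_pos[of k] by (simp add: col_def divide_strict_right_mono less_imp_le divide_less_cancel)
  have col_ends: "col 0 = site k" "col (turns k) = site k + width k"
    by (simp_all add: col_def)
  have "ennreal (card {l..<l+m} * (d - c)) \<le>
      hausdorff1 (rectangle s e c d \<inter> graph_point profile ` T)"
  proof (rule hausdorff1_graph_crossings[where a="\<lambda>i. col (real i)" and b="\<lambda>i. col (real i + 1/2)"])
    show "continuous_on T profile" by (rule continuous_on_profile)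
    show "disjoint_family_on (\<lambda>i. {col (real i)..col (real i + 1/2)}) {l..<l+m}"
      unfolding disjoint_family_on_def
    proof (intro ballI impI)
      fix i j :: nat assume "i \<noteq> j"
      then have "real i + 1/2 < real j \<or> real j + 1/2 < real i"
        by (cases "i < j") linarith+
      then have "col (real i + 1/2) < col (real j) \<or> col (real j + 1/2) < col (real i)"
        by (simp only: col_less)
      then show "{col (real i)..col (real i + 1/2)} \<inter> {col (real j)..col (real j + 1/2)} = {}"
        by auto
    qed
    fix i assume i: "i \<in> {l..<l+m}"
    then have r: "real l \<le> real i" "real i + 1/2 \<le> real (l + m)" "real i + 1/2 \<le> real (turns k)"
      using l by auto
    have "s \<le> col (real i)" "col (real i + 1/2) \<le> e"
      using col_mono[OF r(1)] col_mono[OF r(2)] s e by (simp_all add: col_def)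
    moreover have "site k \<le> col (real i)" "col (real i + 1/2) \<le> site k + width k"
      using col_mono[of 0 "real i"] col_mono[OF r(3)] by (simp_all add: col_ends)
    ultimately show "{col (real i)..col (real i + 1/2)} \<subseteq> {s..e} \<inter> T"
      using T by auto
    have le: "col (real i) \<le> col (real i + 1/2)" by (rule col_mono) simp
    have in1: "site k \<le> col (real i)" "col (real i) \<le> site k + width k"
      and in2: "site k \<le> col (real i + 1/2)" "col (real i + 1/2) \<le> site k + width k"
      using \<open>site k \<le> col (real i)\<close> \<open>col (real i + 1/2) \<le> site k + width k\<close> le by linarith+
    have "phase k (col (real i)) = real i" "phase k (col (real i + 1/2)) = real i + 1/2"
      unfolding col_def using l i r(3) by (auto intro!: phase_in_cluster)
    then have "wiggle k (col (real i)) = 0" "wiggle k (col (real i + 1/2)) = height k"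
      by (simp_all add: wiggle_def sin_npi2 mult.commute[of pi] ring_distribs sin_add minus_one_power_iff)
    then have "profile (col (real i)) \<le> c" "d \<le> profile (col (real i + 1/2))"
      using profile_near_wiggle(1)[OF in1] profile_near_wiggle(2)[OF in2] cd
        height_pos[of k]
      unfolding b_def[symmetric] by linarith+
    then show "col (real i) \<le> col (real i + 1/2) \<and>
        profile (col (real i)) \<le> c \<and> d \<le> profile (col (real i + 1/2))"
      using le by simp
  qed simp
  then show ?thesis by simp
qed

text \<open>
  Each corner of the square spans a quarter of the columns and a quarter of the height of the square,
  hence carries at least a sixteenth of \<open>turns k * width k\<close>. The lower side \<open>c\<close> lies above
  the lowest points of all columns, and \<open>width k \<le> height k / 2\<close> keeps the upper side below the
  highest points.
\<close>

lemma hausdorff1_cluster_corners: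
  assumes T: "{site k..site k + width k} \<subseteq> T"
  defines "c \<equiv> (\<Sum>j<k. wiggle j (site k)) + height k / 4"
  assumes Q: "Q \<in> corners (site k) c (width k)"
  shows "ennreal (turns k * width k / 16) \<le> hausdorff1 (Q \<inter> graph_point profile ` T)"
proof -
  obtain m where m: "turns k = 4 * m" using four_dvd_turns by blast
  then have "m > 0" using turns_pos[of k] by simp
  have frac: "real 0 * width k / turns k = 0" "(real 0 + real m) * width k / turns k = width k / 4"
      "real (3 * m) * width k / turns k = 3 * width k / 4"
      "(real (3 * m) + real m) * width k / turns k = width k"
    using \<open>m > 0\<close> by (simp_all add: m)
  have w4: "width k / 4 + height k / 4 \<le> 3 * height k / 4"
    "width k + height k / 4 \<le> 3 * height k / 4"
    using width_le[of k] width_pos[of k] by linarith+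
  have c4: "c = (\<Sum>j<k. wiggle j (site k)) + height k / 4" "width k \<ge> 0" by (simp_all add: c_def)
  have mass: "turns k * width k / 16 = m * (width k / 4)" by (simp add: m)
  note col = hausdorff1_cluster_columns[OF T]
  consider "Q = rectangle (site k) (site k + width k/4) c (c + width k/4)"
    | "Q = rectangle (site k + 3*width k/4) (site k + width k) c (c + width k/4)"
    | "Q = rectangle (site k) (site k + width k/4) (c + 3*width k/4) (c + width k)"
    using Q by (auto simp: corners_def)
  then show ?thesis
  proof cases
    case 1
    have "ennreal (m * ((c + width k/4) - c)) \<le> hausdorff1 (Q \<inter> graph_point profile ` T)"
      unfolding 1
      by (rule col[of 0 m]) (simp_all only: frac, (use m w4 c4 in linarith)+)
    then show ?thesis unfolding mass by simp
  next
    case 2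
    have "ennreal (m * ((c + width k/4) - c)) \<le> hausdorff1 (Q \<inter> graph_point profile ` T)"
      unfolding 2
      by (rule col[of "3*m" m]) (simp_all only: frac, (use m w4 c4 in linarith)+)
    then show ?thesis unfolding mass by simp
  next
    case 3
    have "ennreal (m * ((c + width k) - (c + 3*width k/4))) \<le> hausdorff1 (Q \<inter> graph_point profile ` T)"
      unfolding 3
      by (rule col[of 0 m]) (simp_all only: frac, (use m w4 c4 in linarith)+)
    then show ?thesis unfolding mass by simp
  qed
qed

lemma frequently_site_in_interval:
  assumes "a < b"
  obtains k where "n \<le> k" "a < site k" "site k < b"
proof -
  obtain r where r: "r \<in> \<rat>" "a < r" "r < b" using Rats_dense_in_real[OF assms] by auto
  obtain i where i: "from_nat_into \<rat> i = r"
    using from_nat_into_surj[OF countable_rat r(1)] by auto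
  show ?thesis
    using that[of "prod_encode (i, n)"] i r by (simp add: site_def le_prod_encode_2)
qed

theorem theorem1p1:
  shows "\<exists>K0 :: (real^2) set. rectifiable_curve K0 \<and>
    (\<forall>x\<in>K0. \<forall>\<delta>>0.
      (\<integral>\<^sup>+y\<in>ball x \<delta>.
         (\<integral>\<^sup>+r\<in>{0<..<\<delta>}.
            (jones_beta (hausdorff1_restrict K0) y r)^2 * ennreal (1 / r) \<partial>lborel)
       \<partial>(hausdorff1_restrict K0)) = \<infinity>)"
proof (intro exI conjI ballI allI impI)
  let ?K = "graph_point profile ` {0..1}"
  show "rectifiable_curve ?K" by (rule rectifiable_profile_graph)
  fix x :: "real^2" and \<delta> :: real
  assume "x \<in> ?K" and \<delta>: "\<delta> > 0"
  then obtain t0 where t0: "t0 \<in> {0..1}" "x = graph_point profile t0" by auto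
  let ?I = "\<integral>\<^sup>+y\<in>ball x \<delta>. (\<integral>\<^sup>+r\<in>{0<..<\<delta>}.
      (jones_beta (hausdorff1_restrict ?K) y r)^2 * ennreal (1 / r) \<partial>lborel) \<partial>(hausdorff1_restrict ?K)"
  have "continuous_on {0..1} (graph_point profile)"
    by (intro continuous_on_graph_point continuous_on_profile)
  then obtain \<eta> where \<eta>: "\<eta> > 0"
    "\<And>t. t \<in> {0..1} \<Longrightarrow> dist t t0 < \<eta> \<Longrightarrow> dist (graph_point profile t) x < \<delta>"
    unfolding continuous_on_iff using t0 \<delta> by metis
  define a b where "a = max 0 (t0 - \<eta>/2)" and "b = min 1 (t0 + \<eta>/2)"
  have ab: "a < b" "0 \<le> a" "b \<le> 1" using t0(1) \<eta>(1) by (auto simp: a_def b_def)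
  have near: "graph_point profile t \<in> ball x \<delta>" if "t \<in> {a..b}" for t
    using that \<eta>(2)[of t] \<eta>(1) ab by (auto simp: a_def b_def dist_real_def dist_commute)
  have "(\<lambda>k. (1/4::real) ^ k) \<longlonglongrightarrow> 0" by (rule LIMSEQ_power_zero) simp
  then have "\<forall>\<^sub>F k in sequentially. (1/4) ^ k < min ((b - a) / 2) (\<delta> / 4)"
    using ab \<delta> by (intro order_tendstoD) auto
  then obtain n0 where n0: "\<And>k. n0 \<le> k \<Longrightarrow> (1/4) ^ k < min ((b - a) / 2) (\<delta> / 4)"
    by (auto simp: eventually_sequentially)
  have large: "ennreal (2 ^ n / 2 ^ 23) \<le> ?I" for n
  proof -
    (* A site in the left half leaves room for the whole cluster inside {a..b}. *)
    obtain k where k: "max n n0 \<le> k" "a < site k" "site k < (a + b) / 2"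
      using frequently_site_in_interval[of a "(a + b) / 2" "max n n0"] ab by auto
    have "width k \<le> (1/4) ^ k" using width_le(2)[of k] cluster_scale_le(2)[of k] by simp
    then have small: "width k < (b - a) / 2" "4 * width k \<le> \<delta>"
      using n0[of k] k by auto
    have sub: "{site k..site k + width k} \<subseteq> {a..b}"
      using k small by auto
    define c where "c = (\<Sum>j<k. wiggle j (site k)) + height k / 4"
    define m where "m = turns k * width k / 16"
    define Q where "Q = rectangle (site k) (site k + width k/4) c (c + width k/4)"
    have QC: "Q \<in> corners (site k) c (width k)" by (simp add: Q_def corners_def)
    have "{site k..site k + width k} \<subseteq> {0..1}" using sub ab by auto
    then have mass: "ennreal m \<le> emeasure (hausdorff1_restrict ?K) R"
      if "R \<in> corners (site k) c (width k)" for R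
      using hausdorff1_cluster_corners[of k "{0..1}" R] that sets_corners[OF that]
      by (simp add: emeasure_hausdorff1_restrict c_def m_def)
    have "Q \<inter> ?K \<subseteq> ball x \<delta>"
    proof
      fix z assume "z \<in> Q \<inter> ?K"
      then obtain t where "z = graph_point profile t" "t \<in> {site k..site k + width k/4}"
        by (auto simp: Q_def rectangle_def)
      then show "z \<in> ball x \<delta>"
        using near[of t] sub width_pos[of k] by (auto simp del: width_pos)
    qed
    then have "Q \<inter> ball x \<delta> \<inter> ?K = Q \<inter> ?K" by blast
    then have mass': "ennreal m \<le> emeasure (hausdorff1_restrict ?K) (Q \<inter> ball x \<delta>)"
      using mass[OF QC] sets_corners[OF QC] by (simp add: emeasure_hausdorff1_restrict)
    (* The exponent 23 is 15 from the constant below plus 8 from the factor 1/16 in m. *)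
    have "ennreal (2 ^ n / 2 ^ 23) \<le> ennreal (m\<^sup>2 / (2 ^ 15 * width k))"
    proof (rule ennreal_leI)
      have "m\<^sup>2 / (2 ^ 15 * width k) = (real (turns k))\<^sup>2 * width k / 2 ^ 23"
        using width_pos[of k] by (simp add: m_def power2_eq_square field_simps del: width_pos)
      moreover have "(2::real) ^ n \<le> 2 ^ k" using k(1) by (intro power_increasing) auto
      moreover have "(2::real) ^ k / 2 ^ 23 \<le> (real (turns k))\<^sup>2 * width k / 2 ^ 23"
        by (intro divide_right_mono turns_squared_width) simp
      ultimately show "2 ^ n / 2 ^ 23 \<le> m\<^sup>2 / (2 ^ 15 * width k)"
        by (smt (verit) divide_right_mono zero_le_power)
    qed
    also have "\<dots> \<le> ?I"
      using mass mass' small corners_subset[OF less_imp_le[OF width_pos] QC] sets_corners[OF QC]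
      by (intro square_function_corners[where a="site k" and c=c and S="Q \<inter> ball x \<delta>"])
        (auto simp: m_def less_imp_le)
    finally show ?thesis .
  qed
  show "?I = \<infinity>"
  proof (rule ccontr)
    assume "?I \<noteq> \<infinity>"
    then obtain r where r: "?I = ennreal r" "r \<ge> 0" by (cases ?I) auto
    obtain n where "r * 2 ^ 23 < 2 ^ n" using real_arch_pow[of 2 "r * 2 ^ 23"] by auto
    then have "r < 2 ^ n / 2 ^ 23" by (simp add: field_simps)
    then have "ennreal r < ennreal (2 ^ n / 2 ^ 23)" using r(2) by (intro ennreal_lessI) auto
    then show False using large[of n] r(1) by simp
  qed
qed

end
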